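(* Let $V$ be a separable Hilbert space, let $F:V\to\mathbb{R}$ be continuous, coercive and sequentially weakly lower semicontinuous, and let $\mathbf{K}\subset V$ be non-empty, closed and convex. Let $\{V_n\}_{n\in\mathbb{N}}$ be finite-dimensional subspaces of $V$ with $V_n\subset V_{n+1}$ for all $n\in\mathbb{N}$ and $\overline{\bigcup_{n\in\mathbb{N}}V_n}^{V}=V$, and set $Y:=\bigcup_{n\in\mathbb{N}}V_n$. Suppose that $$\overline{\mathbf{K}\cap Y}\subsetneq\mathbf{K}.$$ Then for each $w\in\mathbf{K}\setminus\overline{\mathbf{K}\cap Y}$ there exists a strictly increasing sequence of positive numbers $\{\gamma_n\}$ with $\gamma_n\to\infty$ such that there is no strong recovery sequence at $w$, i.e., $$F(y_n)+R_n(y_n)\nrightarrow F(w)$$ for all sequences $\{y_n\}$ in $V$ with $y_n\to w$ in $V$, where $$R_n(u)=\frac{\gamma_n}{2}\inf_{v\in\mathbf{K}}\|u-v\|^2+i_{V_n}(u),\qquad u\in V.$$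
   Context: For a set $C\subset V$, the indicator function $i_C:V\to\mathbb{R}\cup\{+\infty\}$ equals $0$ on $C$ and $+\infty$ outside $C$. Closures are taken in the norm of $V$. Coercive means $F(u)\to+\infty$ as $\|u\|\to\infty$. *)

theory Defs
  imports "HOL-Analysis.Analysis"
begin

text \<open>Real Hilbert spaces are rendered by the sort \<open>{real_inner, complete_space}\<close>.\<close>

definition weakly_converges :: "(nat \<Rightarrow> 'a::real_normed_vector) \<Rightarrow> 'a \<Rightarrow> bool" where
  "weakly_converges u l \<longleftrightarrow> (\<forall>f::'a \<Rightarrow> real. bounded_linear f \<longrightarrow> (\<lambda>n. f (u n)) \<longlonglongrightarrow> f l)"

text \<open>The liminf is taken in \<^typ>\<open>ereal\<close>, since it may be infinite along a given sequence.\<close>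

definition seq_weakly_lsc :: "('a::real_normed_vector \<Rightarrow> real) \<Rightarrow> bool" where
  "seq_weakly_lsc F \<longleftrightarrow>
    (\<forall>u l. weakly_converges u l \<longrightarrow> ereal (F l) \<le> liminf (\<lambda>n. ereal (F (u n))))"

definition coercive :: "('a::real_normed_vector \<Rightarrow> real) \<Rightarrow> bool" where
  "coercive F \<longleftrightarrow> filterlim F at_top at_infinity"

text \<open>Stated through a finite spanning set: \<^const>\<open>dim\<close> is \<open>0\<close> on infinite-dimensional
  subspaces and so does not detect finite dimension.\<close>

definition fin_dim_subspace :: "'a::real_vector set \<Rightarrow> bool" where
  "fin_dim_subspace S \<longleftrightarrow> subspace S \<and> (\<exists>B. finite B \<and> span B = S)"

text \<open>Not to be confused with the \<open>0\<close>/\<open>1\<close>-valued \<^const>\<open>indicator\<close>.\<close>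

definition convex_indicator :: "'a set \<Rightarrow> 'a \<Rightarrow> ereal" where
  "convex_indicator C u = (if u \<in> C then 0 else \<infinity>)"

definition penalty_reg :: "'a::real_normed_vector set \<Rightarrow> (nat \<Rightarrow> 'a set) \<Rightarrow> (nat \<Rightarrow> real) \<Rightarrow> nat
    \<Rightarrow> 'a \<Rightarrow> ereal" where
  "penalty_reg K V \<gamma> n u =
     ereal (\<gamma> n / 2 * (INF v\<in>K. (norm (u - v))\<^sup>2)) + convex_indicator (V n) u"

end

theory Submission
  imports Defs
begin

text \<open>
  Any point \<open>w\<close> outside the closure of \<open>K \<inter> Y\<close> has a closed ball \<open>B\<close> around it that
  misses \<open>K \<inter> V n\<close> for every \<open>n\<close>. Since \<open>V n\<close> is finite-dimensional, \<open>V n \<inter> B\<close> is compact,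
  so being disjoint from the closed set \<open>K\<close> it has a positive distance \<open>\<delta> n\<close> from it
  (\<open>compact_fin_dim_Int_cball\<close>, \<open>compact_closed_positive_distance\<close>). These distances may tend
  to \<open>0\<close>, but the penalty parameter may be chosen to be at least \<open>2 / (\<delta> n)\<^sup>2\<close>: then every
  point of \<open>V n \<inter> B\<close> pays a penalty of at least \<open>1\<close>, and every point outside \<open>V n\<close> pays \<open>\<infinity>\<close>
  (\<open>penalty_reg_ge_one\<close>). A sequence converging to \<open>w\<close> is eventually in \<open>B\<close>, so along it the
  regularised functional eventually exceeds \<open>F\<close> by at least \<open>1\<close>; as \<open>F\<close> is continuous, its
  values cannot converge to \<open>F w\<close>.
\<close>

text \<open>The coefficient box is a product of compact intervals; adding one generator at a time turns
  this into a Minkowski sum of a segment and a compact set.\<close>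

lemma compact_bounded_combinations:
  fixes C :: "'a::real_normed_vector set"
  assumes "finite C"
  shows "compact {(\<Sum>c\<in>C. a c *\<^sub>R c) | a. \<forall>c\<in>C. \<bar>a c\<bar> \<le> M c}"
  using assms
proof (induction C)
  case empty
  then show ?case by simp
next
  case (insert c C)
  let ?T = "{(\<Sum>c\<in>C. a c *\<^sub>R c) | a. \<forall>c\<in>C. \<bar>a c\<bar> \<le> M c}"
  let ?S = "(\<lambda>t. t *\<^sub>R c) ` {- M c .. M c}"
  have "compact ?S"
    by (intro compact_continuous_image continuous_intros compact_Icc)
  then have "compact {x + y | x y. x \<in> ?S \<and> y \<in> ?T}"
    using insert.IH by (rule compact_sums)
  moreover have "{(\<Sum>d\<in>insert c C. a d *\<^sub>R d) | a. \<forall>d\<in>insert c C. \<bar>a d\<bar> \<le> M d}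
      = {x + y | x y. x \<in> ?S \<and> y \<in> ?T}" (is "?L = ?R")
  proof (intro equalityI subsetI)
    fix z assume "z \<in> ?L"
    then obtain a where a: "\<forall>d\<in>insert c C. \<bar>a d\<bar> \<le> M d" "z = (\<Sum>d\<in>insert c C. a d *\<^sub>R d)"
      by blast
    have "z = a c *\<^sub>R c + (\<Sum>d\<in>C. a d *\<^sub>R d)"
      using a(2) insert.hyps by simp
    moreover have "a c *\<^sub>R c \<in> ?S"
      using a(1) by (auto simp: abs_le_iff)
    ultimately show "z \<in> ?R"
      using a(1) by blast
  next
    fix z assume "z \<in> ?R"
    then obtain t a where "t \<in> {- M c .. M c}" and a: "\<forall>d\<in>C. \<bar>a d\<bar> \<le> M d"
      and z: "z = t *\<^sub>R c + (\<Sum>d\<in>C. a d *\<^sub>R d)"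
      by blast
    then have t: "\<bar>t\<bar> \<le> M c"
      by (simp add: abs_le_iff)
    have "(\<Sum>d\<in>C. (a(c := t)) d *\<^sub>R d) = (\<Sum>d\<in>C. a d *\<^sub>R d)"
      using insert.hyps by (intro sum.cong) auto
    then have "z = (\<Sum>d\<in>insert c C. (a(c := t)) d *\<^sub>R d)"
      using z insert.hyps by simp
    moreover have "\<forall>d\<in>insert c C. \<bar>(a(c := t)) d\<bar> \<le> M d"
      using t a by simp
    ultimately show "z \<in> ?L" by blast
  qed
  ultimately show ?case by simp
qed

text \<open>With respect to an orthogonal basis the coefficients of a vector are bounded by its norm, so
  a bounded piece of the subspace lies in the image of a compact coefficient box.\<close>

lemma compact_fin_dim_Int_cball:
  fixes S :: "'a::real_inner set"
  assumes "fin_dim_subspace S"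
  shows "compact (S \<inter> cball w r)"
proof -
  obtain B where "finite B" and B: "span B = S"
    using assms unfolding fin_dim_subspace_def by blast
  then obtain C where C: "finite C" "span C = S" "pairwise orthogonal C"
    using basis_orthogonal[of B] by metis
  define M where "M = (\<lambda>c::'a. (norm w + r) / norm c)"
  define D where "D = C - {0}"
  have D: "finite D" "span D = S" "pairwise orthogonal D" "0 \<notin> D"
    using C unfolding D_def by (auto simp: span_delete_0 pairwise_def)
  let ?T = "{(\<Sum>c\<in>D. a c *\<^sub>R c) | a. \<forall>c\<in>D. \<bar>a c\<bar> \<le> M c}"
  have "S \<inter> cball w r = ?T \<inter> cball w r"
  proof (intro equalityI subsetI)
    fix v assume v: "v \<in> S \<inter> cball w r"
    then obtain a where a: "v = (\<Sum>c\<in>D. a c *\<^sub>R c)"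
      using D(2) span_finite[OF D(1)] by auto
    have "norm v \<le> norm w + r"
      using v norm_triangle_sub[of v w] by (simp add: dist_norm norm_minus_commute)
    moreover have "\<bar>a c\<bar> * norm c \<le> norm v" if "c \<in> D" for c
    proof -
      have "v \<bullet> c = (\<Sum>d\<in>D. a d * (d \<bullet> c))"
        unfolding a by (simp add: inner_sum_left)
      also have "\<dots> = (\<Sum>d\<in>D. if d = c then a c * (norm c)\<^sup>2 else 0)"
        using D(3) that
        by (intro sum.cong) (auto simp: pairwise_def orthogonal_def power2_norm_eq_inner)
      also have "\<dots> = a c * (norm c)\<^sup>2"
        using D(1) that by simp
      finally have "\<bar>a c\<bar> * norm c * norm c \<le> norm v * norm c"
        using Cauchy_Schwarz_ineq2[of v c] by (simp add: abs_mult power2_eq_square)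
      then show ?thesis
        using D(4) that by (metis mult_right_le_imp_le zero_less_norm_iff)
    qed
    ultimately have "\<bar>a c\<bar> * norm c \<le> norm w + r" if "c \<in> D" for c
      using that by (meson order_trans)
    moreover have "0 < norm c" if "c \<in> D" for c
      using that D(4) by auto
    ultimately have "\<forall>c\<in>D. \<bar>a c\<bar> \<le> M c"
      unfolding M_def by (simp add: pos_le_divide_eq)
    then show "v \<in> ?T \<inter> cball w r"
      using a v by blast
  next
    fix v assume "v \<in> ?T \<inter> cball w r"
    then show "v \<in> S \<inter> cball w r"
      using D(2) by (auto intro: span_sum span_scale span_base)
  qed
  then show ?thesis
    using compact_Int_closed[OF compact_bounded_combinations[OF D(1)] closed_cball] by simp
qed

text \<open>Infinite-dimensional spaces lack the Heine-Borel property, but compactness of one of the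
  two sets is enough: the distance to \<open>T\<close> is continuous and attains its minimum on \<open>S\<close>.\<close>

lemma compact_closed_positive_distance:
  fixes S T :: "'a::metric_space set"
  assumes "compact S" and "closed T" and "S \<inter> T = {}"
  obtains d where "0 < d" and "\<And>x y. x \<in> S \<Longrightarrow> y \<in> T \<Longrightarrow> d \<le> dist x y"
proof (cases "S = {} \<or> T = {}")
  case True
  then show ?thesis using that[of 1] by auto
next
  case False
  have "continuous_on S (\<lambda>x. infdist x T)"
    by (intro continuous_intros)
  then obtain x where x: "x \<in> S" "\<And>y. y \<in> S \<Longrightarrow> infdist x T \<le> infdist y T"
    using continuous_attains_inf[OF assms(1)] False by blast
  have "0 < infdist x T"
    using infdist_pos_not_in_closed[OF assms(2)] False x(1) assms(3) by blast
  then show ?thesis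
    using x(2) infdist_le order_trans that by metis
qed

text \<open>The inequality \<open>2 / \<delta>\<^sup>2 \<le> \<gamma> n\<close> turns the lower bound \<open>\<delta>\<^sup>2\<close> for the squared distance to
  \<open>K\<close> into the lower bound \<open>1\<close> for the penalty; outside \<open>V n\<close> the indicator is infinite.\<close>

lemma penalty_reg_ge_one:
  assumes "K \<noteq> {}" and "0 < \<delta>" and "2 / \<delta>\<^sup>2 \<le> \<gamma> n"
    and far: "\<And>v. u \<in> V n \<Longrightarrow> v \<in> K \<Longrightarrow> \<delta> \<le> dist u v"
  shows "1 \<le> penalty_reg K V \<gamma> n u"
proof (cases "u \<in> V n")
  case True
  have "\<delta>\<^sup>2 \<le> (INF v\<in>K. (norm (u - v))\<^sup>2)"
    using assms True by (intro cINF_greatest power_mono) (auto simp: dist_norm)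
  moreover have "1 / \<delta>\<^sup>2 \<le> \<gamma> n / 2"
    using assms(3) by simp
  ultimately have "1 / \<delta>\<^sup>2 * \<delta>\<^sup>2 \<le> \<gamma> n / 2 * (INF v\<in>K. (norm (u - v))\<^sup>2)"
    using assms(2) by (intro mult_mono) (auto intro: order_trans[rotated])
  then show ?thesis
    using True assms(2) by (simp add: penalty_reg_def convex_indicator_def)
next
  case False
  then show ?thesis by (simp add: penalty_reg_def convex_indicator_def)
qed

theorem theorem4p3:
  fixes F :: "'a::{real_inner, complete_space} \<Rightarrow> real"
    and K :: "'a set"
    and V :: "nat \<Rightarrow> 'a set"
    and Y :: "'a set"
  assumes "separable_space (euclidean :: 'a topology)"
    and "continuous_on UNIV F"
    and "coercive F"
    and "seq_weakly_lsc F"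
    and "K \<noteq> {}" and "closed K" and "convex K"
    and "\<And>n. fin_dim_subspace (V n)"
    and "\<And>n. V n \<subseteq> V (Suc n)"
    and "closure (\<Union>n. V n) = UNIV"
    and "Y = (\<Union>n. V n)"
    and "closure (K \<inter> Y) \<subset> K"
  shows "\<forall>w \<in> K - closure (K \<inter> Y). \<exists>\<gamma>::nat \<Rightarrow> real.
           strict_mono \<gamma> \<and> (\<forall>n. 0 < \<gamma> n) \<and> filterlim \<gamma> at_top sequentially \<and>
           (\<forall>y::nat \<Rightarrow> 'a. y \<longlonglongrightarrow> w \<longrightarrow>
              \<not> (\<lambda>n. ereal (F (y n)) + penalty_reg K V \<gamma> n (y n)) \<longlonglongrightarrow> ereal (F w))"
proof
  fix w assume w: "w \<in> K - closure (K \<inter> Y)"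
  then obtain r where r: "0 < r" "cball w r \<subseteq> - closure (K \<inter> Y)"
    using open_contains_cball[of "- closure (K \<inter> Y)"] by (auto simp: open_Compl)
  have "\<exists>d. 0 < d \<and> (\<forall>x\<in>V n \<inter> cball w r. \<forall>v\<in>K. d \<le> dist x v)" for n
  proof -
    have "compact (V n \<inter> cball w r)"
      using assms(8) by (rule compact_fin_dim_Int_cball)
    moreover have "(V n \<inter> cball w r) \<inter> K = {}"
      using r(2) closure_subset[of "K \<inter> Y"] assms(11) by blast
    ultimately show ?thesis
      using compact_closed_positive_distance[OF _ assms(6)] by metis
  qed
  then obtain \<delta> where \<delta>: "\<And>n. 0 < \<delta> n"
    "\<And>n x v. x \<in> V n \<inter> cball w r \<Longrightarrow> v \<in> K \<Longrightarrow> \<delta> n \<le> dist x v"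
    by metis
  \<comment> \<open>Partial sums dominate \<open>2 / (\<delta> n)\<^sup>2\<close> and are increasing even if \<open>\<delta>\<close> is not monotone;
    the summand \<open>1\<close> forces divergence.\<close>
  define \<gamma> where "\<gamma> n = (\<Sum>k\<le>n. 2 / (\<delta> k)\<^sup>2 + 1)" for n
  have pos: "0 < 2 / (\<delta> k)\<^sup>2 + 1" for k
    by (simp add: add_nonneg_pos)
  have "strict_mono \<gamma>"
    unfolding strict_mono_Suc_iff \<gamma>_def using pos by simp
  moreover have "0 < \<gamma> n" for n
    unfolding \<gamma>_def using pos by (intro sum_pos) auto
  moreover have "filterlim \<gamma> at_top sequentially"
  proof (rule filterlim_at_top_mono[OF filterlim_real_sequentially])
    have "real n \<le> \<gamma> n" for n
    proof -
      have "real n \<le> (\<Sum>k\<le>n. 1)" by simp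
      also have "\<dots> \<le> \<gamma> n"
        unfolding \<gamma>_def by (intro sum_mono) simp
      finally show ?thesis .
    qed
    then show "\<forall>\<^sub>F n in sequentially. real n \<le> \<gamma> n" by simp
  qed
  moreover have "\<not> (\<lambda>n. ereal (F (y n)) + penalty_reg K V \<gamma> n (y n)) \<longlonglongrightarrow> ereal (F w)"
    if y: "y \<longlonglongrightarrow> w" for y
  proof
    assume lim: "(\<lambda>n. ereal (F (y n)) + penalty_reg K V \<gamma> n (y n)) \<longlonglongrightarrow> ereal (F w)"
    have \<gamma>_ge: "2 / (\<delta> n)\<^sup>2 \<le> \<gamma> n" for n
    proof -
      have "2 / (\<delta> n)\<^sup>2 + 1 \<le> \<gamma> n"
        unfolding \<gamma>_def using pos by (intro member_le_sum less_imp_le) auto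
      then show ?thesis by simp
    qed
    have "\<forall>\<^sub>F n in sequentially. dist (y n) w < r"
      using tendstoD[OF y r(1)] .
    then have "\<forall>\<^sub>F n in sequentially.
        ereal (F (y n) + 1) \<le> ereal (F (y n)) + penalty_reg K V \<gamma> n (y n)"
    proof eventually_elim
      case (elim n)
      then have "y n \<in> cball w r"
        by (simp add: dist_commute)
      with \<delta>(2) have "\<delta> n \<le> dist (y n) v" if "y n \<in> V n" "v \<in> K" for v
        using that by blast
      with assms(5) \<delta>(1) \<gamma>_ge have "1 \<le> penalty_reg K V \<gamma> n (y n)"
        by (rule penalty_reg_ge_one)
      then have "ereal (F (y n)) + 1 \<le> ereal (F (y n)) + penalty_reg K V \<gamma> n (y n)"
        by (rule add_left_mono)
      then show ?case by (simp add: one_ereal_def)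
    qed
    moreover have "(\<lambda>n. F (y n)) \<longlonglongrightarrow> F w"
      using continuous_on_tendsto_compose[OF assms(2) y] by simp
    then have "(\<lambda>n. ereal (F (y n) + 1)) \<longlonglongrightarrow> ereal (F w + 1)"
      by (intro tendsto_ereal tendsto_intros)
    ultimately have "ereal (F w + 1) \<le> ereal (F w)"
      by (intro tendsto_le[OF trivial_limit_sequentially lim])
    then show False by simp
  qed
  ultimately show "\<exists>\<gamma>::nat \<Rightarrow> real.
      strict_mono \<gamma> \<and> (\<forall>n. 0 < \<gamma> n) \<and> filterlim \<gamma> at_top sequentially \<and>
      (\<forall>y::nat \<Rightarrow> 'a. y \<longlonglongrightarrow> w \<longrightarrow>
         \<not> (\<lambda>n. ereal (F (y n)) + penalty_reg K V \<gamma> n (y n)) \<longlonglongrightarrow> ereal (F w))"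
    by blast
qed

end
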